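(* Let $\mathcal G=(\mathcal E,\{m_e\},\{d_i\})$ be a tree tensor network: a finite tree (connected graph without loops) with vertices $i=1,\dots,N$ and edge set $\mathcal E$, with integer bond dimensions $m_e\ge 1$ for $e\in\mathcal E$ and integer site dimensions $d_i\ge1$ for the vertices. Let $\mathcal H=\bigotimes_{i=1}^N\mathbb C^{d_i}$. Then the set $\mathrm{TTNS}(\mathcal G)\subseteq\mathcal H$ of normalized tree tensor network states for $\mathcal G$ is closed in $\mathcal H$, and it coincides with the set of all normalized states in $\mathcal H$ whose Schmidt rank $\tilde m_e$ with respect to the bipartition of the vertices into $\mathcal A_e$ and $\mathcal B_e$ satisfies $\tilde m_e\le m_e$ for every edge $e\in\mathcal E$, where $\mathcal A_e$ and $\mathcal B_e$ are the vertex sets of the two connected components obtained by removing $e$ from the tree.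
   Context: Each $\mathbb C^{d_i}$ has orthonormal basis $\{|\sigma_i\rangle:\sigma_i=1,\dots,d_i\}$. Closedness is with respect to the norm topology of the finite-dimensional space $\mathcal H$; normalized means norm $1$. For a vertex $i$ let $\partial i\subseteq\mathcal E$ be the set of edges incident to $i$. A tree tensor network state for $\mathcal G$ is obtained by assigning to each vertex $i$ a tensor $A_i\in\mathbb C^{d_i\times\prod_{e\in\partial i}m_e}$, i.e. with one physical index $\sigma_i\in\{1,\dots,d_i\}$ and one bond index $n_e\in\{1,\dots,m_e\}$ for each $e\in\partial i$, and contracting: $$|\Psi\rangle=\sum_{\sigma_1,\dots,\sigma_N}\ \sum_{\{n_e\}_{e\in\mathcal E}}\ \prod_{i=1}^N[A_i^{\sigma_i}]_{(n_e)_{e\in\partial i}}\ |\sigma_1,\dots,\sigma_N\rangle .$$ $\mathrm{TTNS}(\mathcal G)$ is the set of all such states with $\|\Psi\|=1$. The Schmidt rank of $|\psi\rangle\in\mathcal H_{\mathcal A}\otimes\mathcal H_{\mathcal B}$ is the number of nonzero Schmidt coefficients, i.e. the rank of the coefficient matrix of $|\psi\rangle$ with respect to product bases. *)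

theory Defs
  imports "HOL-Analysis.Analysis" "HOL-Library.Function_Algebras"
begin

section \<open>Trees\<close>

text \<open>An undirected simple graph is a vertex set \<open>V\<close> with a set \<open>E\<close> of two-element subsets of \<open>V\<close>.\<close>

definition adjacency :: "'v set set \<Rightarrow> ('v \<times> 'v) set" where
  "adjacency E = {(u, v). {u, v} \<in> E}"

definition graph_component :: "'v set set \<Rightarrow> 'v \<Rightarrow> 'v set" where
  "graph_component E v = (adjacency E)\<^sup>* `` {v}"

definition graph_cycle :: "'v set set \<Rightarrow> 'v list \<Rightarrow> bool" where
  "graph_cycle E p \<longleftrightarrow>
     3 \<le> length p \<and> distinct p \<and> successively (\<lambda>u v. {u, v} \<in> E) (p @ [hd p])"

definition is_tree :: "'v set \<Rightarrow> 'v set set \<Rightarrow> bool" where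
  "is_tree V E \<longleftrightarrow>
     finite V \<and> V \<noteq> {} \<and>
     E \<subseteq> {{u, v} | u v. u \<in> V \<and> v \<in> V \<and> u \<noteq> v} \<and>
     (\<forall>v\<in>V. graph_component E v = V) \<and>
     (\<nexists>p. graph_cycle E p)"

definition incident :: "'v set set \<Rightarrow> 'v \<Rightarrow> 'v set set" where
  "incident E i = {e \<in> E. i \<in> e}"


section \<open>The tensor product of the site spaces\<close>

text \<open>
  A vector in the tensor product of complex spaces of dimension \<open>d i\<close>, \<open>i \<in> V\<close>, is given by its
  coefficients in the orthonormal product basis, which is indexed by the set \<open>configs d V\<close>.
  Coefficients off this set are fixed to be 0, so that equality of vectors is equality of functions.
\<close>

definition configs :: "('v \<Rightarrow> nat) \<Rightarrow> 'v set \<Rightarrow> ('v \<Rightarrow> nat) set" where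
  "configs d V = (\<Pi>\<^sub>E i\<in>V. {1..d i})"

definition state_space :: "('v \<Rightarrow> nat) \<Rightarrow> 'v set \<Rightarrow> (('v \<Rightarrow> nat) \<Rightarrow> complex) set" where
  "state_space d V = {\<psi>. \<forall>\<sigma>. \<sigma> \<notin> configs d V \<longrightarrow> \<psi> \<sigma> = 0}"

definition state_norm :: "('v \<Rightarrow> nat) \<Rightarrow> 'v set \<Rightarrow> (('v \<Rightarrow> nat) \<Rightarrow> complex) \<Rightarrow> real" where
  "state_norm d V \<psi> = L2_set (\<lambda>\<sigma>. cmod (\<psi> \<sigma>)) (configs d V)"

definition state_dist ::
  "('v \<Rightarrow> nat) \<Rightarrow> 'v set \<Rightarrow> (('v \<Rightarrow> nat) \<Rightarrow> complex) \<Rightarrow> (('v \<Rightarrow> nat) \<Rightarrow> complex) \<Rightarrow> real" where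
  "state_dist d V \<phi> \<psi> = state_norm d V (\<lambda>\<sigma>. \<phi> \<sigma> - \<psi> \<sigma>)"

lemma Metric_space_state_space:
  assumes "finite V"
  shows "Metric_space (state_space d V) (state_dist d V)"
proof
  have fin: "finite (configs d V)"
    unfolding configs_def using assms by (intro finite_PiE) auto
  fix \<phi> \<psi> \<eta> :: "('a \<Rightarrow> nat) \<Rightarrow> complex"
  show "0 \<le> state_dist d V \<phi> \<psi>"
    by (simp add: state_dist_def state_norm_def)
  show "state_dist d V \<phi> \<psi> = state_dist d V \<psi> \<phi>"
    by (simp add: state_dist_def state_norm_def norm_minus_commute)
  show "(state_dist d V \<phi> \<psi> = 0) = (\<phi> = \<psi>)"
    if "\<phi> \<in> state_space d V" "\<psi> \<in> state_space d V"
    using that fin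
    by (force simp: state_dist_def state_norm_def state_space_def L2_set_eq_0_iff fun_eq_iff)
  have "state_dist d V \<phi> \<eta> \<le>
      L2_set (\<lambda>\<sigma>. cmod (\<phi> \<sigma> - \<psi> \<sigma>) + cmod (\<psi> \<sigma> - \<eta> \<sigma>)) (configs d V)"
    unfolding state_dist_def state_norm_def
    by (intro L2_set_mono) (auto intro: norm_triangle_sub norm_diff_triangle_le)
  also have "\<dots> \<le> state_dist d V \<phi> \<psi> + state_dist d V \<psi> \<eta>"
    unfolding state_dist_def state_norm_def by (rule L2_set_triangle_ineq)
  finally show "state_dist d V \<phi> \<eta> \<le> state_dist d V \<phi> \<psi> + state_dist d V \<psi> \<eta>" .
qed

abbreviation state_topology ::
  "('v \<Rightarrow> nat) \<Rightarrow> 'v set \<Rightarrow> (('v \<Rightarrow> nat) \<Rightarrow> complex) topology" where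
  "state_topology d V \<equiv> Metric_space.mtopology (state_space d V) (state_dist d V)"


section \<open>Tree tensor network states\<close>

text \<open>
  In \<open>T i s n\<close>, \<open>i\<close> is the vertex, \<open>s\<close> its physical index and \<open>n\<close> the family of the bond indices of
  the edges incident to \<open>i\<close>. Values of \<open>T\<close> at other arguments do not enter the contraction.
\<close>

definition contract ::
  "'v set \<Rightarrow> 'v set set \<Rightarrow> ('v set \<Rightarrow> nat) \<Rightarrow> ('v \<Rightarrow> nat) \<Rightarrow>
   ('v \<Rightarrow> nat \<Rightarrow> ('v set \<Rightarrow> nat) \<Rightarrow> complex) \<Rightarrow> ('v \<Rightarrow> nat) \<Rightarrow> complex" where
  "contract V E m d T = (\<lambda>\<sigma>.
     if \<sigma> \<in> configs d V
     then \<Sum>n\<in>(\<Pi>\<^sub>E e\<in>E. {1..m e}). \<Prod>i\<in>V. T i (\<sigma> i) (restrict n (incident E i))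
     else 0)"

definition TTNS ::
  "'v set \<Rightarrow> 'v set set \<Rightarrow> ('v set \<Rightarrow> nat) \<Rightarrow> ('v \<Rightarrow> nat) \<Rightarrow> (('v \<Rightarrow> nat) \<Rightarrow> complex) set" where
  "TTNS V E m d = {\<psi>. (\<exists>T. \<psi> = contract V E m d T) \<and> state_norm d V \<psi> = 1}"


section \<open>Schmidt rank\<close>

lemma vector_space_complex_functions:
  "vector_space (\<lambda>(c::complex) f i. c * f i)"
  by unfold_locales (auto simp: algebra_simps fun_eq_iff)

text \<open>The rank of the matrix with entries \<open>M i j\<close>, \<open>i \<in> I\<close>, \<open>j \<in> J\<close>: the dimension of its column space.\<close>

definition matrix_rank :: "'i set \<Rightarrow> 'j set \<Rightarrow> ('i \<Rightarrow> 'j \<Rightarrow> complex) \<Rightarrow> nat" where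
  "matrix_rank I J M =
     vector_space.dim (\<lambda>(c::complex) f i. c * f i) ((\<lambda>j i. if i \<in> I then M i j else 0) ` J)"

definition schmidt_rank ::
  "('v \<Rightarrow> nat) \<Rightarrow> 'v set \<Rightarrow> 'v set \<Rightarrow> (('v \<Rightarrow> nat) \<Rightarrow> complex) \<Rightarrow> nat" where
  "schmidt_rank d A B \<psi> =
     matrix_rank (configs d A) (configs d B) (\<lambda>\<sigma> \<tau>. \<psi> (merge A B (\<sigma>, \<tau>)))"

end

theory Submission
  imports Defs
begin

text \<open>
  Cutting an edge \<open>e\<close> splits the sum over the bond indices into \<open>m e\<close> products of a factor for each
  side, so the Schmidt ranks of a tree tensor network state are bounded by the bond dimensions.
  The converse is an induction that removes a leaf \<open>l\<close> with neighbour \<open>p\<close>. The rank bound at the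
  edge between them gives \<open>\<psi> \<sigma> = (\<Sum>k. c k (\<sigma> l) * \<psi> (\<sigma>(l := x k)))\<close> with \<open>m {l, p}\<close>
  fixed values \<open>x k\<close>. The slices \<open>\<psi> (\<sigma>(l := x k))\<close> form a state on the smaller tree in which the
  physical index of \<open>p\<close> is the pair of \<open>\<sigma> p\<close> and \<open>k\<close>; as \<open>l\<close> and \<open>p\<close> are on the same side of every
  other edge, this state satisfies the remaining rank bounds. Closedness then follows from lower
  semicontinuity of the rank: independent columns have dual functionals, and a matrix near the
  identity is invertible because it is strictly diagonally dominant.
\<close>

section \<open>Trees built by adding leaves\<close>

text \<open>This gives trees an induction principle: each step attaches one new leaf
  \<open>l\<close> to an existing vertex \<open>p\<close>. Both inclusions of the characterization
  are proved by this induction.\<close>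

inductive leaf_tree :: "'v set \<Rightarrow> 'v set set \<Rightarrow> bool" where
  single: "leaf_tree {v} {}"
| leaf: "leaf_tree V E \<Longrightarrow> p \<in> V \<Longrightarrow> l \<notin> V \<Longrightarrow> leaf_tree (insert l V) (insert {l, p} E)"

lemma leaf_tree_edges: "leaf_tree V E \<Longrightarrow> \<Union>E \<subseteq> V"
  by (induction rule: leaf_tree.induct) auto

lemma leaf_tree_finite: "leaf_tree V E \<Longrightarrow> finite V"
  by (induction rule: leaf_tree.induct) auto

text \<open>A path without repeated vertices is what is needed to exhibit a cycle once a further
  edge joins its endpoints. A path to or from the new leaf extends a path to or from
  \<open>p\<close>.\<close>

lemma leaf_tree_path:
  assumes "leaf_tree V E" "a \<in> V" "b \<in> V"
  shows "\<exists>xs. xs \<noteq> [] \<and> hd xs = a \<and> last xs = b \<and> distinct xs \<and> set xs \<subseteq> V \<and>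
    successively (\<lambda>u v. {u, v} \<in> E) xs"
  using assms
proof (induction arbitrary: a b rule: leaf_tree.induct)
  case (single v)
  then show ?case by (intro exI[of _ "[v]"]) auto
next
  case (leaf V E p l)
  have mono: "successively (\<lambda>u v. {u, v} \<in> insert {l, p} E) xs"
    if "successively (\<lambda>u v. {u, v} \<in> E) xs" for xs
    using that by (rule successively_mono) auto
  consider "a = l" "b = l" | "a \<in> V" "b \<in> V" | "a = l" "b \<in> V" | "a \<in> V" "b = l"
    using leaf.prems by auto
  then show ?case
  proof cases
    case 1
    then show ?thesis by (intro exI[of _ "[l]"]) auto
  next
    case 2
    then show ?thesis using leaf.IH[of a b] mono by blast
  next
    case 3
    then obtain xs where "xs \<noteq> []" "hd xs = p" "last xs = b" "distinct xs" "set xs \<subseteq> V"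
      "successively (\<lambda>u v. {u, v} \<in> E) xs"
      using leaf.IH[of p b] leaf.hyps by blast
    then show ?thesis
      using 3 leaf.hyps mono[of xs] by (intro exI[of _ "l # xs"]) (auto simp: successively_Cons)
  next
    case 4
    then obtain xs where "xs \<noteq> []" "hd xs = a" "last xs = p" "distinct xs" "set xs \<subseteq> V"
      "successively (\<lambda>u v. {u, v} \<in> E) xs"
      using leaf.IH[of a p] leaf.hyps by blast
    then show ?thesis
      using 4 leaf.hyps mono[of xs]
      by (intro exI[of _ "xs @ [l]"]) (auto simp: successively_append_iff insert_commute)
  qed
qed

text \<open>Take a maximal vertex set \<open>W\<close> that carries a leaf tree with edges
  \<open>F\<close> from \<open>E\<close>. An edge leaving \<open>W\<close> would attach another
  leaf, so connectedness gives \<open>W = V\<close>. An edge of \<open>E\<close> outside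
  \<open>F\<close> would close a path in \<open>F\<close> to a cycle.\<close>

lemma is_tree_imp_leaf_tree:
  assumes "is_tree V E"
  shows "leaf_tree V E"
proof -
  have finV: "finite V" and "V \<noteq> {}" and conn: "\<And>v. v \<in> V \<Longrightarrow> graph_component E v = V"
    and edges: "E \<subseteq> {{u, v} | u v. u \<in> V \<and> v \<in> V \<and> u \<noteq> v}"
    and acyclic: "\<And>p. \<not> graph_cycle E p"
    using assms by (auto simp: is_tree_def)
  define Q where "Q W \<longleftrightarrow> W \<subseteq> V \<and> (\<exists>F\<subseteq>E. leaf_tree W F)" for W
  obtain r where "r \<in> V" using \<open>V \<noteq> {}\<close> by auto
  then have "Q {r}" by (auto simp: Q_def intro: leaf_tree.single)
  moreover have "finite {W. Q W}"
    by (rule finite_subset[of _ "Pow V"]) (auto simp: Q_def finV)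
  ultimately obtain W where W: "Q W" "\<And>W'. Q W' \<Longrightarrow> W \<subseteq> W' \<Longrightarrow> W' = W"
    using finite_has_maximal[of "{W. Q W}"] by (metis empty_iff mem_Collect_eq)
  then obtain F where F: "F \<subseteq> E" "leaf_tree W F" and WV: "W \<subseteq> V" by (auto simp: Q_def)
  have "W \<noteq> {}" using F(2) by (cases rule: leaf_tree.cases) auto
  then obtain w where w: "w \<in> W" by auto
  have closed: "y \<in> W" if "x \<in> W" "{x, y} \<in> E" for x y
  proof (rule ccontr)
    assume "y \<notin> W"
    then have "leaf_tree (insert y W) (insert {y, x} F)"
      using F(2) that(1) by (intro leaf_tree.leaf)
    moreover have "y \<in> V" using edges that(2) by (fastforce simp: doubleton_eq_iff)
    ultimately have "Q (insert y W)"
      using F(1) WV that(2) unfolding Q_def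
      by (intro conjI exI[of _ "insert {y, x} F"]) (auto simp: insert_commute)
    then show False using W(2)[of "insert y W"] \<open>y \<notin> W\<close> by blast
  qed
  have "x \<in> W" if "(w, x) \<in> (adjacency E)\<^sup>*" for x
    using that w by (induction rule: rtrancl_induct) (auto simp: adjacency_def intro: closed)
  then have "V \<subseteq> W" using conn[of w] w WV by (auto simp: graph_component_def)
  then have WV_eq: "W = V" using WV by auto
  have "E \<subseteq> F"
  proof
    fix e assume "e \<in> E"
    then obtain a b where e: "e = {a, b}" "a \<in> V" "b \<in> V" "a \<noteq> b" using edges by blast
    obtain xs where xs: "xs \<noteq> []" "hd xs = a" "last xs = b" "distinct xs"
      "successively (\<lambda>u v. {u, v} \<in> F) xs"
      using leaf_tree_path[OF F(2)] e WV_eq by blast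
    show "e \<in> F"
    proof (rule ccontr)
      assume "e \<notin> F"
      \<comment> \<open>One vertex is excluded by \<open>a \<noteq> b\<close>, and the path
        \<open>[a, b]\<close> would put \<open>e\<close> into \<open>F\<close>.\<close>
      have "3 \<le> length xs"
      proof (rule ccontr)
        assume "\<not> 3 \<le> length xs"
        then consider x where "xs = [x]" | x y where "xs = [x, y]"
          using xs(1) by (cases xs; cases "tl xs"; cases "tl (tl xs)") auto
        then show False using xs e \<open>e \<notin> F\<close> by cases auto
      qed
      moreover have "successively (\<lambda>u v. {u, v} \<in> E) xs"
        using xs(5) by (rule successively_mono) (use F in auto)
      ultimately have "graph_cycle E xs"
        using xs e \<open>e \<in> E\<close> by (auto simp: graph_cycle_def successively_append_iff insert_commute)
      then show False using acyclic by blast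
    qed
  qed
  then show ?thesis using F WV_eq by auto
qed

section \<open>Components under adding a leaf and removing an edge\<close>

lemma graph_component_add_leaf:
  assumes "l \<notin> \<Union>F" "x \<noteq> l" "p \<noteq> l"
  shows "graph_component (insert {l, p} F) x =
    (if p \<in> graph_component F x then insert l (graph_component F x) else graph_component F x)"
proof -
  have mono: "(adjacency F)\<^sup>* \<subseteq> (adjacency (insert {l, p} F))\<^sup>*"
    by (rule rtrancl_mono) (auto simp: adjacency_def)
  \<comment> \<open>A walk can enter and leave \<open>l\<close> only through \<open>p\<close>. The
    invariant therefore remembers, while the walk stands at \<open>l\<close>, that \<open>p\<close>
    is reachable in \<open>F\<close>; this covers the step back to \<open>p\<close>.\<close>
  have "y = l \<and> (x, p) \<in> (adjacency F)\<^sup>* \<or> y \<noteq> l \<and> (x, y) \<in> (adjacency F)\<^sup>*"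
    if "(x, y) \<in> (adjacency (insert {l, p} F))\<^sup>*" for y
    using that
  proof (induction rule: rtrancl_induct)
    case (step y z)
    then have "{y, z} = {l, p} \<or> {y, z} \<in> F" by (auto simp: adjacency_def)
    then consider "y = l" "z = p" | "y = p" "z = l" | "{y, z} \<in> F" "y \<noteq> l" "z \<noteq> l"
      using assms(1) by (auto simp: doubleton_eq_iff)
    then show ?case
    proof cases
      case 3
      then have "(y, z) \<in> adjacency F" by (simp add: adjacency_def)
      then show ?thesis using 3 step.IH by (auto intro: rtrancl_into_rtrancl)
    qed (use step.IH assms in auto)
  qed (use assms in auto)
  moreover have "(x, l) \<in> (adjacency (insert {l, p} F))\<^sup>*" if "(x, p) \<in> (adjacency F)\<^sup>*"
  proof (rule rtrancl_into_rtrancl)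
    show "(x, p) \<in> (adjacency (insert {l, p} F))\<^sup>*" using that mono by auto
  qed (auto simp: adjacency_def)
  ultimately show ?thesis
    using mono by (auto simp: graph_component_def)
qed

lemma graph_component_isolated:
  assumes "l \<notin> \<Union>F"
  shows "graph_component F l = {l}"
proof -
  have "y = l" if "(l, y) \<in> (adjacency F)\<^sup>*" for y
    using that by (induction rule: rtrancl_induct) (use assms in \<open>auto simp: adjacency_def\<close>)
  then show ?thesis by (auto simp: graph_component_def)
qed

lemma graph_component_eq:
  assumes "y \<in> graph_component F x"
  shows "graph_component F y = graph_component F x"
proof -
  have "sym ((adjacency F)\<^sup>*)"
    by (intro sym_rtrancl) (auto simp: sym_def adjacency_def insert_commute)
  then have "(y, x) \<in> (adjacency F)\<^sup>*" "(x, y) \<in> (adjacency F)\<^sup>*"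
    using assms by (auto simp: graph_component_def dest: symD)
  then show ?thesis by (auto simp: graph_component_def)
qed

lemma leaf_tree_connected: "leaf_tree V E \<Longrightarrow> v \<in> V \<Longrightarrow> graph_component E v = V"
proof (induction arbitrary: v rule: leaf_tree.induct)
  case (single u)
  then show ?case using graph_component_isolated[of u "{}"] by auto
next
  case (leaf V E p l)
  have notin: "l \<notin> \<Union>E" using leaf_tree_edges[OF leaf.hyps(1)] leaf.hyps(3) by blast
  have "p \<noteq> l" using leaf.hyps by auto
  have eq: "graph_component (insert {l, p} E) v = insert l V" if "v \<in> V" for v
  proof -
    have "v \<noteq> l" using that leaf.hyps(3) by auto
    from graph_component_add_leaf[OF notin this \<open>p \<noteq> l\<close>] show ?thesis
      using leaf.IH[OF that] leaf.hyps(2) by simp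
  qed
  moreover have "graph_component (insert {l, p} E) l = insert l V"
    using graph_component_eq[of l "insert {l, p} E" p] eq[of p] leaf.hyps(2) by (metis insertI1)
  ultimately show ?case using leaf.prems by auto
qed

text \<open>If the removed edge is the one at the new leaf, the components are \<open>{l}\<close>
  and \<open>V\<close>. Otherwise \<open>l\<close> joins whichever of the two old components
  contains \<open>p\<close>.\<close>

lemma leaf_tree_split:
  assumes "leaf_tree V E" "{a, b} \<in> E"
  shows "graph_component (E - {{a, b}}) a \<inter> graph_component (E - {{a, b}}) b = {} \<and>
    graph_component (E - {{a, b}}) a \<union> graph_component (E - {{a, b}}) b = V"
  using assms
proof (induction arbitrary: a b rule: leaf_tree.induct)
  case (single v)
  then show ?case by simp
next
  case (leaf V E p l)
  have notin: "l \<notin> \<Union>E" using leaf_tree_edges[OF leaf.hyps(1)] leaf.hyps(3) by blast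
  have "p \<noteq> l" using leaf.hyps by auto
  show ?case
  proof (cases "{a, b} = {l, p}")
    case True
    then have "insert {l, p} E - {{a, b}} = E" using notin by auto
    moreover have "graph_component E l = {l}" using notin by (rule graph_component_isolated)
    moreover have "graph_component E p = V" using leaf_tree_connected[OF leaf.hyps(1,2)] .
    moreover have "a = l \<and> b = p \<or> a = p \<and> b = l" using True by (auto simp: doubleton_eq_iff)
    ultimately show ?thesis using leaf.hyps(3) by (elim disjE conjE) simp_all
  next
    case False
    then have ab: "{a, b} \<in> E" "a \<noteq> l" "b \<noteq> l" using leaf.prems notin by auto
    have eq: "insert {l, p} E - {{a, b}} = insert {l, p} (E - {{a, b}})" using False by auto
    have notin': "l \<notin> \<Union>(E - {{a, b}})" using notin by auto
    define C where "C x = graph_component (E - {{a, b}}) x" for x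
    have C: "graph_component (insert {l, p} E - {{a, b}}) x =
        (if p \<in> C x then insert l (C x) else C x)" if "x \<noteq> l" for x
      using graph_component_add_leaf[OF notin' that \<open>p \<noteq> l\<close>] unfolding eq C_def .
    have disj: "C a \<inter> C b = {}" and un: "C a \<union> C b = V"
      using leaf.IH[OF ab(1)] unfolding C_def by blast+
    have "p \<in> C a \<and> p \<notin> C b \<or> p \<notin> C a \<and> p \<in> C b" "l \<notin> C a" "l \<notin> C b"
      using disj un leaf.hyps(2,3) by blast+
    then show ?thesis
      unfolding C[OF ab(2)] C[OF ab(3)] using disj un by (elim disjE) simp_all
  qed
qed

section \<open>Matrix rank\<close>

lemma sum_fun_apply: "(\<Sum>a\<in>A. f a) x = (\<Sum>a\<in>A. f a x)"
  by (induction A rule: infinite_finite_induct) auto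

interpretation cfun: vector_space "\<lambda>(c::complex) f i. c * f i"
  by (rule vector_space_complex_functions)

text \<open>Pairing the function space with its scalar field makes linear functionals available,
  which \<open>independent_dual\<close> extends from an independent set.\<close>

interpretation cfun_functional: vector_space_pair "\<lambda>(c::complex) f i. c * f i" "(*) :: complex \<Rightarrow> complex \<Rightarrow> complex"
proof -
  have "vector_space ((*) :: complex \<Rightarrow> complex \<Rightarrow> complex)"
    by unfold_locales (simp_all add: algebra_simps)
  then show "vector_space_pair (\<lambda>(c::complex) f i. c * f i) ((*) :: complex \<Rightarrow> complex \<Rightarrow> complex)"
    by (rule vector_space_pair.intro[OF vector_space_complex_functions])
qed

text \<open>This is the column map inside \<open>matrix_rank\<close>. Having it as a function of the
  column index allows injectivity to be stated, so that independent columns can be counted by their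
  indices.\<close>

definition matrix_columns :: "'i set \<Rightarrow> ('i \<Rightarrow> 'j \<Rightarrow> complex) \<Rightarrow> 'j \<Rightarrow> 'i \<Rightarrow> complex" where
  "matrix_columns I M j = (\<lambda>i. if i \<in> I then M i j else 0)"

lemma matrix_rank_columns: "matrix_rank I J M = cfun.dim (matrix_columns I M ` J)"
  by (simp add: matrix_rank_def matrix_columns_def)

text \<open>A spanning set contains a basis, so a basis of the column space can be chosen among the
  columns; one index is then picked for each basis vector.\<close>

lemma matrix_rank_column_basis:
  assumes "finite J"
  obtains J0 where "J0 \<subseteq> J" "card J0 = matrix_rank I J M"
    "inj_on (matrix_columns I M) J0" "cfun.independent (matrix_columns I M ` J0)"
    "matrix_columns I M ` J \<subseteq> cfun.span (matrix_columns I M ` J0)"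
proof -
  obtain B where B: "B \<subseteq> matrix_columns I M ` J" "cfun.independent B"
    "matrix_columns I M ` J \<subseteq> cfun.span B" "card B = cfun.dim (matrix_columns I M ` J)"
    using cfun.basis_exists by blast
  obtain J0 where J0: "J0 \<subseteq> J" "inj_on (matrix_columns I M) J0" "B = matrix_columns I M ` J0"
    using B(1) by (auto simp: subset_image_inj)
  show ?thesis
    using that[of J0] J0 B by (auto simp: matrix_rank_columns card_image)
qed

text \<open>Every column is a combination of the \<open>r\<close> left factors, so the column space
  lies in the span of at most \<open>r\<close> vectors.\<close>

lemma matrix_rank_le_factor:
  assumes "\<And>i j. i \<in> I \<Longrightarrow> j \<in> J \<Longrightarrow> M i j = (\<Sum>k\<in>{1..r}. u k i * v k j)"
  shows "matrix_rank I J M \<le> r"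
proof -
  define U where "U k = (\<lambda>i. if i \<in> I then u k i else 0)" for k :: nat
  have "matrix_columns I M j \<in> cfun.span (U ` {1..r})" if "j \<in> J" for j
  proof -
    have "matrix_columns I M j = (\<Sum>k\<in>{1..r}. (\<lambda>i. v k j * U k i))"
      using assms that by (auto simp: matrix_columns_def U_def sum_fun_apply fun_eq_iff mult.commute)
    also have "\<dots> \<in> cfun.span (U ` {1..r})"
      by (intro cfun.span_sum cfun.span_scale cfun.span_base) auto
    finally show ?thesis .
  qed
  then have "matrix_rank I J M \<le> card (U ` {1..r})"
    unfolding matrix_rank_columns by (intro cfun.dim_le_card) auto
  also have "\<dots> \<le> r" using card_image_le[of "{1..r}" U] by simp
  finally show ?thesis .
qed

text \<open>
  The left factors are columns of \<open>M\<close> itself, so they inherit every property that \<open>M\<close> has as a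
  function of \<open>i\<close>.
\<close>

lemma matrix_rank_le_interpolate:
  assumes "finite J" "J \<noteq> {}" "matrix_rank I J M \<le> r"
  obtains x :: "nat \<Rightarrow> 'j" and c where "\<And>k. x k \<in> J"
    "\<And>i j. i \<in> I \<Longrightarrow> j \<in> J \<Longrightarrow> M i j = (\<Sum>k\<in>{1..r}. M i (x k) * c k j)"
proof -
  obtain J0 where J0: "J0 \<subseteq> J" "card J0 = matrix_rank I J M" "inj_on (matrix_columns I M) J0"
    "matrix_columns I M ` J \<subseteq> cfun.span (matrix_columns I M ` J0)"
    using matrix_rank_column_basis[OF assms(1)] by metis
  have finJ0: "finite J0" using J0(1) assms(1) finite_subset by blast
  have "\<exists>a. \<forall>i\<in>I. M i j = (\<Sum>b\<in>J0. a b * M i b)" if j: "j \<in> J" for j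
  proof -
    have "matrix_columns I M j \<in> cfun.span (matrix_columns I M ` J0)" using J0(4) j by auto
    then obtain a where "matrix_columns I M j = (\<Sum>f\<in>matrix_columns I M ` J0. (\<lambda>i. a f * f i))"
      using finJ0 by (subst (asm) cfun.span_finite) auto
    then have a: "matrix_columns I M j =
        (\<Sum>b\<in>J0. (\<lambda>i. a (matrix_columns I M b) * matrix_columns I M b i))"
      using J0(3) by (simp add: sum.reindex)
    have "M i j = (\<Sum>b\<in>J0. a (matrix_columns I M b) * M i b)" if "i \<in> I" for i
      using fun_cong[OF a, of i] that by (simp add: sum_fun_apply matrix_columns_def)
    then show ?thesis by (intro exI[of _ "\<lambda>b. a (matrix_columns I M b)"]) simp
  qed
  then obtain a where a: "\<And>i j. i \<in> I \<Longrightarrow> j \<in> J \<Longrightarrow> M i j = (\<Sum>b\<in>J0. a j b * M i b)"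
    by metis
  obtain h where h: "bij_betw h {1..card J0} J0"
    using ex_bij_betw_nat_finite_1[OF finJ0] by blast
  obtain j0 where "j0 \<in> J" using assms(2) by auto
  \<comment> \<open>The basis may have fewer than \<open>r\<close> elements: surplus indices get an
    arbitrary column \<open>j0\<close>, with coefficient 0.\<close>
  define x where "x k = (if k \<in> {1..card J0} then h k else j0)" for k
  define c where "c k j = (if k \<in> {1..card J0} then a j (h k) else 0)" for k j
  show ?thesis
  proof (rule that[of x c])
    show "x k \<in> J" for k
      using bij_betw_imp_surj_on[OF h] J0(1) \<open>j0 \<in> J\<close> by (auto simp: x_def)
    fix i j assume ij: "i \<in> I" "j \<in> J"
    have "M i j = (\<Sum>k\<in>{1..card J0}. a j (h k) * M i (h k))"
      using a[OF ij] sum.reindex_bij_betw[OF h, of "\<lambda>b. a j b * M i b"] by simp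
    also have "\<dots> = (\<Sum>k\<in>{1..r}. M i (x k) * c k j)"
      using assms(3) J0(2)
      by (intro sum.mono_neutral_cong_left) (auto simp: x_def c_def)
    finally show "M i j = (\<Sum>k\<in>{1..r}. M i (x k) * c k j)" .
  qed
qed

lemma matrix_rank_le_iff_factor:
  assumes "finite J"
  shows "matrix_rank I J M \<le> r \<longleftrightarrow>
    (\<exists>u v. \<forall>i\<in>I. \<forall>j\<in>J. M i j = (\<Sum>k\<in>{1..r}. u k i * v k j))" (is "_ \<longleftrightarrow> ?R")
proof
  assume r: "matrix_rank I J M \<le> r"
  show ?R
  proof (cases "J = {}")
    case False
    then obtain x :: "nat \<Rightarrow> _" and c where
      "\<And>i j. i \<in> I \<Longrightarrow> j \<in> J \<Longrightarrow> M i j = (\<Sum>k\<in>{1..r}. M i (x k) * c k j)"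
      using matrix_rank_le_interpolate[OF assms False r] by metis
    then show ?thesis by (intro exI[of _ "\<lambda>k i. M i (x k)"] exI[of _ c]) simp
  qed auto
next
  assume ?R
  then obtain u v where "\<forall>i\<in>I. \<forall>j\<in>J. M i j = (\<Sum>k\<in>{1..r}. u k i * v k j)" by blast
  then show "matrix_rank I J M \<le> r" by (intro matrix_rank_le_factor[where u = u and v = v]) blast
qed

section \<open>Lower semicontinuity of the rank\<close>

lemma independent_dual:
  assumes "finite I" "finite J" "inj_on (matrix_columns I M) J"
    "cfun.independent (matrix_columns I M ` J)"
  obtains w where "\<And>a b. a \<in> J \<Longrightarrow> b \<in> J \<Longrightarrow> (\<Sum>i\<in>I. w a i * M i b) = (if a = b then 1 else 0)"
proof -
  have "\<exists>w. \<forall>b\<in>J. (\<Sum>i\<in>I. w i * M i b) = (if a = b then 1 else 0)" if a: "a \<in> J" for a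
  proof -
    \<comment> \<open>By independence some linear functional is 1 on column \<open>a\<close> and 0
      on the other columns. Its values at the unit vectors \<open>e i\<close> are the required
      weights.\<close>
    obtain g where g: "Vector_Spaces.linear (\<lambda>(c::complex) f i. c * f i) (*) g"
      and gB: "\<And>f. f \<in> matrix_columns I M ` J \<Longrightarrow> g f = (if f = matrix_columns I M a then 1 else 0)"
      using cfun_functional.linear_independent_extend[OF assms(4),
          of "\<lambda>f. if f = matrix_columns I M a then 1 else 0"] by metis
    interpret g: Vector_Spaces.linear "\<lambda>(c::complex) f i. c * f i" "(*)" g by (rule g)
    define e where "e i = (\<lambda>i'. if i' = i then 1 else 0 :: complex)" for i :: 'a
    have "(\<Sum>i\<in>I. g (e i) * M i b) = (if a = b then 1 else 0)" if b: "b \<in> J" for b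
    proof -
      have "matrix_columns I M b = (\<Sum>i\<in>I. (\<lambda>i'. M i b * e i i'))"
        using assms(1)
        by (auto simp: fun_eq_iff sum_fun_apply matrix_columns_def e_def if_distrib cong: if_cong)
      then have "g (matrix_columns I M b) = (\<Sum>i\<in>I. M i b * g (e i))"
        by (simp add: g.sum g.scale)
      moreover have "g (matrix_columns I M b) = (if a = b then 1 else 0)"
        using gB[of "matrix_columns I M b"] inj_onD[OF assms(3) _ b a] b by auto
      ultimately show ?thesis by (simp add: mult.commute)
    qed
    then show ?thesis by (intro exI[of _ "\<lambda>i. g (e i)"]) simp
  qed
  then show ?thesis using that by metis
qed

text \<open>The weights turn a linear relation among the columns into one for the square matrix
  \<open>G\<close>, whose entries are close to those of the identity. The row of a coefficient of
  largest modulus then forces all coefficients to vanish.\<close>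

lemma independent_of_near_dual:
  assumes "finite J"
    and near: "\<And>a b. a \<in> J \<Longrightarrow> b \<in> J \<Longrightarrow>
      cmod ((\<Sum>i\<in>I. w a i * M i b) - (if a = b then 1 else 0)) < 1 / (1 + real (card J))"
  shows "inj_on (matrix_columns I M) J \<and> cfun.independent (matrix_columns I M ` J)"
proof -
  \<comment> \<open>Coefficients are indexed by \<open>J\<close> rather than by the columns, so this
    yields both injectivity of the column map and independence of its image.\<close>
  have key: "\<forall>b\<in>J. c b = 0" if c: "\<And>i. i \<in> I \<Longrightarrow> (\<Sum>b\<in>J. c b * M i b) = 0" for c
  proof (rule ccontr)
    assume "\<not> (\<forall>b\<in>J. c b = 0)"
    then have "J \<noteq> {}" by auto
    define G where "G a b = (\<Sum>i\<in>I. w a i * M i b)" for a b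
    obtain a where a: "a \<in> J" "\<And>b. b \<in> J \<Longrightarrow> cmod (c b) \<le> cmod (c a)"
      using Max_in[of "(\<lambda>b. cmod (c b)) ` J"] Max_ge[of "(\<lambda>b. cmod (c b)) ` J"] assms(1) \<open>J \<noteq> {}\<close>
      by fastforce
    obtain b0 where "b0 \<in> J" "c b0 \<noteq> 0" using \<open>\<not> (\<forall>b\<in>J. c b = 0)\<close> by blast
    then have "cmod (c a) > 0" using a(2)[of b0] zero_less_norm_iff[of "c b0"] by linarith
    have "(\<Sum>b\<in>J. c b * G a b) = (\<Sum>i\<in>I. w a i * (\<Sum>b\<in>J. c b * M i b))"
      unfolding G_def sum_distrib_left by (subst sum.swap) (simp add: mult_ac)
    also have "\<dots> = 0" using c by simp
    finally have G0: "(\<Sum>b\<in>J. c b * G a b) = 0" .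
    have "(\<Sum>b\<in>J. c b * (G a b - (if a = b then 1 else 0))) =
        (\<Sum>b\<in>J. c b * G a b) - (\<Sum>b\<in>J. if a = b then c b else 0)"
      unfolding sum_subtractf[symmetric] by (intro sum.cong) (auto simp: right_diff_distrib)
    then have ca: "c a = - (\<Sum>b\<in>J. c b * (G a b - (if a = b then 1 else 0)))"
      using assms(1) a(1) G0 by simp
    have "cmod (c a) \<le> (\<Sum>b\<in>J. cmod (c b * (G a b - (if a = b then 1 else 0))))"
      using norm_sum[of "\<lambda>b. c b * (G a b - (if a = b then 1 else 0))" J]
      by (subst ca) (simp only: norm_minus_cancel)
    \<comment> \<open>There are \<open>card J\<close> terms, so the tolerance
      \<open>1 / (1 + card J)\<close> keeps their total strictly below
      \<open>cmod (c a)\<close>.\<close>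
    also have "\<dots> \<le> (\<Sum>b\<in>J. cmod (c a) * (1 / (1 + real (card J))))"
      unfolding norm_mult G_def
      by (intro sum_mono mult_mono a(2) less_imp_le[OF near[OF a(1)]]) auto
    also have "\<dots> = cmod (c a) * (real (card J) / (1 + real (card J)))" by simp
    also have "\<dots> < cmod (c a) * 1"
      using \<open>cmod (c a) > 0\<close> by (intro mult_strict_left_mono) auto
    finally show False by simp
  qed
  have inj: "inj_on (matrix_columns I M) J"
  proof (rule inj_onI, rule ccontr)
    fix a b assume ab: "a \<in> J" "b \<in> J" "matrix_columns I M a = matrix_columns I M b" "a \<noteq> b"
    \<comment> \<open>Two equal columns at different indices satisfy the relation with coefficients
      1 and -1.\<close>
    define c where "c j = (if j = a then 1 else if j = b then -1 else 0 :: complex)" for j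
    have "(\<Sum>j\<in>J. c j * M i j) = 0" if "i \<in> I" for i
    proof -
      have "(\<Sum>j\<in>J. c j * M i j) = (\<Sum>j\<in>{a, b}. c j * M i j)"
        using ab assms(1) by (intro sum.mono_neutral_right) (auto simp: c_def)
      also have "\<dots> = 0"
        using fun_cong[OF ab(3), of i] ab(4) that by (simp add: c_def matrix_columns_def)
      finally show ?thesis .
    qed
    from key[OF this] ab(1) show False by (auto simp: c_def)
  qed
  moreover have "cfun.independent (matrix_columns I M ` J)"
  proof (rule cfun.independent_if_scalars_zero)
    fix f x assume f: "(\<Sum>x\<in>matrix_columns I M ` J. (\<lambda>i. f x * x i)) = 0"
      and x: "x \<in> matrix_columns I M ` J"
    have "(\<Sum>b\<in>J. (\<lambda>i. f (matrix_columns I M b) * matrix_columns I M b i)) = 0"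
      using f inj by (simp add: sum.reindex)
    note f0 = fun_cong[OF this]
    have "(\<Sum>b\<in>J. f (matrix_columns I M b) * M i b) = 0" if "i \<in> I" for i
      using f0[of i] that by (simp add: sum_fun_apply matrix_columns_def)
    from key[OF this] x show "f x = 0" by auto
  qed (use assms(1) in auto)
  ultimately show ?thesis ..
qed

text \<open>Dual weights for a column basis of \<open>L\<close>, applied to the same columns of
  \<open>M n\<close>, give matrices converging to the identity. Hence for some \<open>n\<close>
  these columns of \<open>M n\<close> are independent, and their number is at most
  \<open>r\<close>.\<close>

lemma matrix_rank_le_limit:
  assumes "finite I" "finite J"
    and lim: "\<And>i j. i \<in> I \<Longrightarrow> j \<in> J \<Longrightarrow> (\<lambda>n. M n i j) \<longlonglongrightarrow> L i j"
    and le: "\<And>n::nat. matrix_rank I J (M n) \<le> r"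
  shows "matrix_rank I J L \<le> r"
proof -
  obtain J0 where J0: "J0 \<subseteq> J" "card J0 = matrix_rank I J L"
    "inj_on (matrix_columns I L) J0" "cfun.independent (matrix_columns I L ` J0)"
    using matrix_rank_column_basis[OF assms(2)] by metis
  have finJ0: "finite J0" using J0(1) assms(2) finite_subset by blast
  obtain w where w: "\<And>a b. a \<in> J0 \<Longrightarrow> b \<in> J0 \<Longrightarrow>
      (\<Sum>i\<in>I. w a i * L i b) = (if a = b then 1 else 0)"
    using independent_dual[OF assms(1) finJ0 J0(3,4)] by metis
  have "\<forall>\<^sub>F n in sequentially. \<forall>a\<in>J0. \<forall>b\<in>J0.
      cmod ((\<Sum>i\<in>I. w a i * M n i b) - (if a = b then 1 else 0)) < 1 / (1 + real (card J0))"
  proof (intro eventually_ball_finite ballI finJ0)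
    fix a b assume ab: "a \<in> J0" "b \<in> J0"
    have "(\<lambda>n. \<Sum>i\<in>I. w a i * M n i b) \<longlonglongrightarrow> (\<Sum>i\<in>I. w a i * L i b)"
      using ab J0(1) by (intro tendsto_intros lim) auto
    from tendstoD[OF this, of "1 / (1 + real (card J0))"] w[OF ab]
    show "\<forall>\<^sub>F n in sequentially.
        cmod ((\<Sum>i\<in>I. w a i * M n i b) - (if a = b then 1 else 0)) < 1 / (1 + real (card J0))"
      by (simp add: dist_norm)
  qed
  then obtain n where "\<forall>a\<in>J0. \<forall>b\<in>J0.
      cmod ((\<Sum>i\<in>I. w a i * M n i b) - (if a = b then 1 else 0)) < 1 / (1 + real (card J0))"
    using eventually_happens' sequentially_bot by blast
  then have ind: "inj_on (matrix_columns I (M n)) J0"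
    "cfun.independent (matrix_columns I (M n) ` J0)"
    using independent_of_near_dual[OF finJ0, where I=I and w=w and M="M n"] by auto
  have "card J0 = cfun.dim (matrix_columns I (M n) ` J0)"
    using cfun.dim_eq_card_independent[OF ind(2)] ind(1) by (simp add: card_image)
  also have "\<dots> \<le> matrix_rank I J (M n)"
  proof -
    obtain J1 where J1: "J1 \<subseteq> J" "card J1 = matrix_rank I J (M n)"
      "matrix_columns I (M n) ` J \<subseteq> cfun.span (matrix_columns I (M n) ` J1)"
      using matrix_rank_column_basis[OF assms(2)] by metis
    have "finite J1" using J1(1) assms(2) finite_subset by blast
    then have "cfun.dim (matrix_columns I (M n) ` J0) \<le> card (matrix_columns I (M n) ` J1)"
      using J1(3) J0(1) by (intro cfun.dim_le_card) auto
    also have "\<dots> \<le> card J1" using card_image_le[OF \<open>finite J1\<close>] .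
    finally show ?thesis using J1(2) by simp
  qed
  finally show ?thesis using J0(2) le[of n] by simp
qed

section \<open>Contraction and factorization across an edge\<close>

lemma sum_PiE_insert:
  assumes "x \<notin> S"
  shows "(\<Sum>f\<in>Pi\<^sub>E (insert x S) T. g f) = (\<Sum>y\<in>T x. \<Sum>f\<in>Pi\<^sub>E S T. g (f(x := y)))"
proof -
  have "(\<Sum>f\<in>Pi\<^sub>E (insert x S) T. g f) =
      (\<Sum>z\<in>T x \<times> Pi\<^sub>E S T. g ((\<lambda>(y, f). f(x := y)) z))"
    unfolding PiE_insert_eq sum.reindex[OF inj_combinator[OF assms]] o_def ..
  then show ?thesis by (simp add: sum.cartesian_product split_def)
qed

text \<open>The contraction without the cutoff to \<open>configs\<close>. Physical indices may be
  any natural numbers, which leaves room for codes of pairs when a leaf is removed.\<close>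

definition bond_sum ::
  "'v set \<Rightarrow> 'v set set \<Rightarrow> ('v set \<Rightarrow> nat) \<Rightarrow> ('v \<Rightarrow> nat \<Rightarrow> ('v set \<Rightarrow> nat) \<Rightarrow> complex) \<Rightarrow>
   ('v \<Rightarrow> nat) \<Rightarrow> complex" where
  "bond_sum V E m T \<sigma> =
     (\<Sum>n\<in>(\<Pi>\<^sub>E e\<in>E. {1..m e}). \<Prod>i\<in>V. T i (\<sigma> i) (restrict n (incident E i)))"

lemma contract_bond_sum:
  "contract V E m d T = (\<lambda>\<sigma>. if \<sigma> \<in> configs d V then bond_sum V E m T \<sigma> else 0)"
  unfolding contract_def bond_sum_def ..

lemma bond_sum_cong:
  assumes "\<And>i n. i \<in> V \<Longrightarrow> n \<in> extensional (incident E i) \<Longrightarrow> T i (\<sigma> i) n = T' i (\<sigma>' i) n"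
  shows "bond_sum V E m T \<sigma> = bond_sum V E m T' \<sigma>'"
  unfolding bond_sum_def by (intro sum.cong prod.cong refl assms) auto

text \<open>
  When a leaf attached to \<open>p\<close> by the edge \<open>e\<close> is removed, the bond index of \<open>e\<close> joins the physical
  index of \<open>p\<close>; the pair of both is encoded as a natural number.
\<close>

definition absorb :: "'v set \<Rightarrow> 'v \<Rightarrow> ('v \<Rightarrow> nat \<Rightarrow> ('v set \<Rightarrow> nat) \<Rightarrow> complex) \<Rightarrow>
    'v \<Rightarrow> nat \<Rightarrow> ('v set \<Rightarrow> nat) \<Rightarrow> complex" where
  "absorb e p T = T(p := (\<lambda>s n. T p (fst (prod_decode s)) (n(e := snd (prod_decode s)))))"

text \<open>The bond index \<open>k\<close> of the leaf edge is summed outermost. The tensor at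
  \<open>l\<close> sees only this bond, the tensor at \<open>p\<close> recovers \<open>k\<close>
  from its encoded physical index, and no other vertex sees it.\<close>

lemma bond_sum_leaf:
  assumes "finite V" "\<Union>E \<subseteq> V" "p \<in> V" "l \<notin> V"
  shows "bond_sum (insert l V) (insert {l, p} E) m T \<sigma> =
    (\<Sum>k\<in>{1..m {l, p}}. T l (\<sigma> l) (\<lambda>e\<in>{{l, p}}. k) *
       bond_sum V E m (absorb {l, p} p T) (\<sigma>(p := prod_encode (\<sigma> p, k))))"
proof -
  let ?e = "{l, p}" and ?E = "insert {l, p} E"
  have notin: "?e \<notin> E" using assms(2,4) by blast
  have inc_l: "incident ?E l = {?e}" using assms(2,4) by (auto simp: incident_def)
  have inc_p: "incident ?E p = insert ?e (incident E p)" by (auto simp: incident_def)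
  have inc: "incident ?E i = incident E i" if "i \<in> V" "i \<noteq> p" for i
    using assms(4) that by (auto simp: incident_def)
  have "(\<Prod>i\<in>insert l V. T i (\<sigma> i) (restrict (n(?e := k)) (incident ?E i))) =
      T l (\<sigma> l) (\<lambda>e\<in>{?e}. k) *
      (\<Prod>i\<in>V. absorb ?e p T i ((\<sigma>(p := prod_encode (\<sigma> p, k))) i) (restrict n (incident E i)))"
    for n k
  proof -
    have "restrict (n(?e := k)) {?e} = (\<lambda>e\<in>{?e}. k)" by (auto simp: fun_eq_iff)
    moreover have "T i (\<sigma> i) (restrict (n(?e := k)) (incident ?E i)) =
        absorb ?e p T i ((\<sigma>(p := prod_encode (\<sigma> p, k))) i) (restrict n (incident E i))"
      if i: "i \<in> V" for i
    proof (cases "i = p")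
      case True
      have "restrict (n(?e := k)) (insert ?e (incident E p)) = (restrict n (incident E p))(?e := k)"
        by (auto simp: fun_eq_iff)
      then show ?thesis using True by (simp add: absorb_def inc_p)
    next
      case False
      have "?e \<notin> incident E i" using notin by (auto simp: incident_def)
      then have "restrict (n(?e := k)) (incident E i) = restrict n (incident E i)"
        by (auto simp: fun_eq_iff)
      then show ?thesis using False by (simp add: absorb_def inc[OF i False])
    qed
    ultimately show ?thesis using assms(1,4) by (simp add: inc_l)
  qed
  then show ?thesis
    unfolding bond_sum_def by (simp add: sum_PiE_insert[OF notin] sum_distrib_left)
qed

text \<open>A rank bound in terms of whole configurations: each factor sees only the coordinates on
  its side. The domain \<open>S\<close> is a parameter because bond sums factor on
  \<open>UNIV\<close>, whereas states are considered on products of index sets that change during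
  the induction.\<close>

definition factorable ::
  "('v \<Rightarrow> nat) set \<Rightarrow> 'v set \<Rightarrow> 'v set \<Rightarrow> nat \<Rightarrow> (('v \<Rightarrow> nat) \<Rightarrow> complex) \<Rightarrow> bool" where
  "factorable S A B r \<psi> \<longleftrightarrow>
     (\<exists>u v. \<forall>\<sigma>\<in>S. \<psi> \<sigma> = (\<Sum>k\<in>{1..r}. u k (restrict \<sigma> A) * v k (restrict \<sigma> B)))"

lemma factorableI:
  assumes "\<And>\<sigma>. \<sigma> \<in> S \<Longrightarrow> \<psi> \<sigma> = (\<Sum>k\<in>{1..r}. u k (restrict \<sigma> A) * v k (restrict \<sigma> B))"
  shows "factorable S A B r \<psi>"
  using assms unfolding factorable_def by blast

lemma factorable_sym: "factorable S A B r \<psi> \<Longrightarrow> factorable S B A r \<psi>"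
  unfolding factorable_def by (subst mult.commute) blast

lemma factorable_restrict:
  assumes "factorable S A B r \<psi>" "S' \<subseteq> S" "\<And>\<sigma>. \<sigma> \<in> S' \<Longrightarrow> \<psi>' \<sigma> = \<psi> \<sigma>"
  shows "factorable S' A B r \<psi>'"
  using assms unfolding factorable_def by (metis subsetD)

text \<open>Every edge occurs in both orientations; together with \<open>factorable_sym\<close> this
  lets proofs assume that \<open>p\<close> lies on the side of \<open>a\<close>.\<close>

definition edge_factorable ::
  "('v \<Rightarrow> nat) set \<Rightarrow> 'v set set \<Rightarrow> ('v set \<Rightarrow> nat) \<Rightarrow> (('v \<Rightarrow> nat) \<Rightarrow> complex) \<Rightarrow> bool" where
  "edge_factorable S E m \<psi> \<longleftrightarrow> (\<forall>a b. {a, b} \<in> E \<longrightarrow>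
     factorable S (graph_component (E - {{a, b}}) a) (graph_component (E - {{a, b}}) b)
       (m {a, b}) \<psi>)"

text \<open>Both the dependence on \<open>l\<close> and the modification at \<open>p\<close> concern
  the side of \<open>A\<close>, so the sum over \<open>k\<close> can be moved into the left factors.
  The right factors are unchanged since \<open>p\<close> is not in \<open>B\<close>.\<close>

lemma factorable_leaf:
  assumes "factorable UNIV A B r \<phi>" "p \<in> A" "p \<notin> B" "l \<notin> A"
    and \<psi>: "\<And>\<sigma>. \<psi> \<sigma> = (\<Sum>k\<in>K. c (\<sigma> l) k * \<phi> (\<sigma>(p := h (\<sigma> p) k)))"
  shows "factorable UNIV (insert l A) B r \<psi>"
proof -
  obtain u v where \<phi>: "\<And>\<sigma>. \<phi> \<sigma> = (\<Sum>j\<in>{1..r}. u j (restrict \<sigma> A) * v j (restrict \<sigma> B))"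
    using assms(1) unfolding factorable_def by blast
  define u' where
    "u' j \<tau> = (\<Sum>k\<in>K. c (\<tau> l) k * u j (restrict (\<tau>(p := h (\<tau> p) k)) A))" for j \<tau>
  have "\<psi> \<sigma> = (\<Sum>j\<in>{1..r}. u' j (restrict \<sigma> (insert l A)) * v j (restrict \<sigma> B))" for \<sigma>
  proof -
    have A: "restrict ((restrict \<sigma> (insert l A))(p := h (\<sigma> p) k)) A =
        restrict (\<sigma>(p := h (\<sigma> p) k)) A" for k
      by (auto simp: fun_eq_iff)
    have B: "restrict (\<sigma>(p := x)) B = restrict \<sigma> B" for x
      using assms(3) by (auto simp: fun_eq_iff)
    have "\<psi> \<sigma> = (\<Sum>k\<in>K. \<Sum>j\<in>{1..r}. c (\<sigma> l) k *
        (u j (restrict (\<sigma>(p := h (\<sigma> p) k)) A) * v j (restrict \<sigma> B)))"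
      unfolding \<psi> \<phi> B by (simp add: sum_distrib_left)
    also have "\<dots> = (\<Sum>j\<in>{1..r}. u' j (restrict \<sigma> (insert l A)) * v j (restrict \<sigma> B))"
      using assms(2)
      by (subst sum.swap) (simp add: u'_def A sum_distrib_right mult.assoc)
    finally show ?thesis .
  qed
  then show ?thesis by (intro factorableI)
qed

text \<open>At the leaf edge, \<open>bond_sum_leaf\<close> is itself a factorization with
  \<open>m {l, p}\<close> terms. At an older edge the induction hypothesis is applied to the
  absorbed tensors, hence the generalization over \<open>T\<close>, and
  \<open>factorable_leaf\<close> restores the leaf.\<close>

lemma bond_sum_edge_factorable:
  assumes "leaf_tree V E"
  shows "edge_factorable UNIV E m (bond_sum V E m T)"
  using assms
proof (induction arbitrary: T rule: leaf_tree.induct)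
  case (single v)
  then show ?case by (simp add: edge_factorable_def)
next
  case (leaf V E p l)
  have notin: "l \<notin> \<Union>E" using leaf_tree_edges[OF leaf.hyps(1)] leaf.hyps(3) by blast
  have "p \<noteq> l" using leaf.hyps by auto
  let ?E = "insert {l, p} E"
  note rec = bond_sum_leaf[OF leaf_tree_finite[OF leaf.hyps(1)] leaf_tree_edges[OF leaf.hyps(1)]
      leaf.hyps(2,3), of m T]
  define u where "u k \<tau> = T l (\<tau> l) (\<lambda>e\<in>{{l, p}}. k)" for k and \<tau> :: "'a \<Rightarrow> nat"
  define v where "v k \<tau> = bond_sum V E m (absorb {l, p} p T) (\<tau>(p := prod_encode (\<tau> p, k)))"
    for k \<tau>
  have new: "factorable UNIV {l} V (m {l, p}) (bond_sum (insert l V) ?E m T)"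
  proof (rule factorableI)
    fix \<sigma> :: "'a \<Rightarrow> nat"
    have "v k (restrict \<sigma> V) =
        bond_sum V E m (absorb {l, p} p T) (\<sigma>(p := prod_encode (\<sigma> p, k)))" for k
      unfolding v_def using leaf.hyps(2) by (intro bond_sum_cong) auto
    then show "bond_sum (insert l V) ?E m T \<sigma> =
        (\<Sum>k\<in>{1..m {l, p}}. u k (restrict \<sigma> {l}) * v k (restrict \<sigma> V))"
      by (simp add: rec u_def)
  qed
  have old: "factorable UNIV (graph_component (?E - {{a, b}}) a) (graph_component (?E - {{a, b}}) b)
      (m {a, b}) (bond_sum (insert l V) ?E m T)"
    if ab: "{a, b} \<in> E" and p: "p \<in> graph_component (E - {{a, b}}) a" for a b
  proof -
    have ne: "a \<noteq> l" "b \<noteq> l" using ab notin by auto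
    have eq: "?E - {{a, b}} = insert {l, p} (E - {{a, b}})" using ab notin by auto
    have notin': "l \<notin> \<Union>(E - {{a, b}})" using notin by auto
    note split = leaf_tree_split[OF leaf.hyps(1) ab]
    have pb: "p \<notin> graph_component (E - {{a, b}}) b" using p split by blast
    have la: "l \<notin> graph_component (E - {{a, b}}) a" using leaf.hyps(3) split by blast
    have "factorable UNIV (graph_component (E - {{a, b}}) a) (graph_component (E - {{a, b}}) b)
        (m {a, b}) (bond_sum V E m (absorb {l, p} p T))"
      using leaf.IH ab unfolding edge_factorable_def by blast
    from factorable_leaf[OF this p pb la rec] show ?thesis
      unfolding eq graph_component_add_leaf[OF notin' ne(1) \<open>p \<noteq> l\<close>]
        graph_component_add_leaf[OF notin' ne(2) \<open>p \<noteq> l\<close>] using p pb by simp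
  qed
  show ?case
    unfolding edge_factorable_def
  proof (intro allI impI)
    fix a b assume ab: "{a, b} \<in> ?E"
    show "factorable UNIV (graph_component (?E - {{a, b}}) a) (graph_component (?E - {{a, b}}) b)
      (m {a, b}) (bond_sum (insert l V) ?E m T)"
    proof (cases "{a, b} = {l, p}")
      case True
      have E: "?E - {{l, p}} = E" using notin by auto
      note comps = graph_component_isolated[OF notin] leaf_tree_connected[OF leaf.hyps(1,2)]
      consider "a = l" "b = p" | "a = p" "b = l" using True by (auto simp: doubleton_eq_iff)
      then show ?thesis
        unfolding True E by cases (use new factorable_sym in \<open>simp_all only: comps, blast\<close>)
    next
      case False
      then have ab': "{a, b} \<in> E" "{b, a} \<in> E" using ab by (auto simp: insert_commute)
      have swap: "{b, a} = {a, b}" by auto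
      have "p \<in> graph_component (E - {{a, b}}) a \<or> p \<in> graph_component (E - {{a, b}}) b"
        using leaf_tree_split[OF leaf.hyps(1) ab'(1)] leaf.hyps(2) by auto
      then show ?thesis
        using old[OF ab'(1)] old[OF ab'(2), unfolded swap] factorable_sym by blast
    qed
  qed
qed

section \<open>Tensors for a state with bounded ranks\<close>

lemma factorable_pullback:
  assumes "factorable S A B r \<psi>"
    and "\<And>\<sigma>. \<sigma> \<in> S' \<Longrightarrow> g \<sigma> \<in> S"
    and "\<And>\<sigma>. restrict (g \<sigma>) A = gA (restrict \<sigma> A')"
    and "\<And>\<sigma>. restrict (g \<sigma>) B = gB (restrict \<sigma> B')"
  shows "factorable S' A' B' r (\<lambda>\<sigma>. \<psi> (g \<sigma>))"
proof -
  obtain u v where "\<And>\<sigma>. \<sigma> \<in> S \<Longrightarrow>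
      \<psi> \<sigma> = (\<Sum>k\<in>{1..r}. u k (restrict \<sigma> A) * v k (restrict \<sigma> B))"
    using assms(1) unfolding factorable_def by blast
  then have "\<psi> (g \<sigma>) = (\<Sum>k\<in>{1..r}. u k (gA (restrict \<sigma> A')) * v k (gB (restrict \<sigma> B')))"
    if "\<sigma> \<in> S'" for \<sigma>
    using assms(2)[OF that] by (simp add: assms(3,4))
  then show ?thesis
    by (rule factorableI[where u = "\<lambda>k \<tau>. u k (gA \<tau>)" and v = "\<lambda>k \<tau>. v k (gB \<tau>)"])
qed

text \<open>The index sets \<open>S i\<close> are arbitrary finite sets because the induction
  replaces \<open>S p\<close> by a set of codes of pairs, which is not an initial interval in
  general.\<close>

lemma edge_factorable_imp_bond_sum:
  assumes "leaf_tree V E" "\<And>i. i \<in> V \<Longrightarrow> finite (S i)" "edge_factorable (Pi\<^sub>E V S) E m \<psi>"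
  shows "\<exists>T. \<forall>\<sigma>\<in>Pi\<^sub>E V S. \<psi> \<sigma> = bond_sum V E m T \<sigma>"
  using assms
proof (induction arbitrary: S \<psi> rule: leaf_tree.induct)
  case (single v)
  have "\<psi> \<sigma> = bond_sum {v} {} m (\<lambda>i s n. \<psi> (\<lambda>i\<in>{v}. s)) \<sigma>" if "\<sigma> \<in> Pi\<^sub>E {v} S" for \<sigma>
  proof -
    have "(\<lambda>i\<in>{v}. \<sigma> v) = \<sigma>" using that by (auto simp: fun_eq_iff PiE_def extensional_def)
    then show ?thesis by (simp add: bond_sum_def)
  qed
  then show ?case by blast
next
  case (leaf V E p l)
  let ?e = "{l, p}" and ?E = "insert {l, p} E"
  have notin: "l \<notin> \<Union>E" using leaf_tree_edges[OF leaf.hyps(1)] leaf.hyps(3) by blast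
  then have e_notin: "?e \<notin> E" by blast
  have "p \<noteq> l" using leaf.hyps by auto
  have finV: "finite V" using leaf_tree_finite[OF leaf.hyps(1)] .
  show ?case
  \<comment> \<open>The values \<open>x k\<close> are chosen in \<open>S l\<close>; if it is empty
    there are no configurations to consider.\<close>
  proof (cases "S l = {}")
    case True
    then have "Pi\<^sub>E (insert l V) S = {}" by (auto simp: PiE_eq_empty_iff)
    then show ?thesis by simp
  next
    case False
    have "?E - {?e} = E" using e_notin by auto
    moreover have "factorable (Pi\<^sub>E (insert l V) S) (graph_component (?E - {?e}) l)
        (graph_component (?E - {?e}) p) (m ?e) \<psi>"
      using leaf.prems(2) unfolding edge_factorable_def by blast
    ultimately have "factorable (Pi\<^sub>E (insert l V) S) {l} V (m ?e) \<psi>"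
      using graph_component_isolated[OF notin] leaf_tree_connected[OF leaf.hyps(1,2)] by simp
    then obtain u v where uv: "\<And>\<sigma>. \<sigma> \<in> Pi\<^sub>E (insert l V) S \<Longrightarrow>
        \<psi> \<sigma> = (\<Sum>k\<in>{1..m ?e}. u k (restrict \<sigma> {l}) * v k (restrict \<sigma> V))"
      unfolding factorable_def by blast
    \<comment> \<open>The index of \<open>l\<close> labels the columns. Interpolation then yields
      left factors that are slices of \<psi> itself, so they keep its factorizations at the other
      edges; \<open>u\<close> and \<open>v\<close> carry no such information.\<close>
    have "matrix_rank (Pi\<^sub>E V S) (S l) (\<lambda>\<tau> s. \<psi> (\<tau>(l := s))) \<le> m ?e"
    proof (rule matrix_rank_le_factor)
      fix \<tau> s assume \<tau>: "\<tau> \<in> Pi\<^sub>E V S" and s: "s \<in> S l"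
      have "\<tau>(l := s) \<in> Pi\<^sub>E (insert l V) S" using \<tau> s by (rule PiE_fun_upd[rotated])
      moreover have "restrict (\<tau>(l := s)) {l} = (\<lambda>i\<in>{l}. s)" "restrict (\<tau>(l := s)) V = \<tau>"
        using \<tau> leaf.hyps(3) by (auto simp: fun_eq_iff PiE_def extensional_def)
      ultimately show "\<psi> (\<tau>(l := s)) = (\<Sum>k\<in>{1..m ?e}. v k \<tau> * u k (\<lambda>i\<in>{l}. s))"
        using uv by (simp add: mult.commute)
    qed
    then obtain x :: "nat \<Rightarrow> nat" and c where x: "\<And>k. x k \<in> S l"
      and c: "\<And>\<tau> s. \<tau> \<in> Pi\<^sub>E V S \<Longrightarrow> s \<in> S l \<Longrightarrow>
        \<psi> (\<tau>(l := s)) = (\<Sum>k\<in>{1..m ?e}. \<psi> (\<tau>(l := x k)) * c k s)"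
      using matrix_rank_le_interpolate[of "S l" "Pi\<^sub>E V S"] leaf.prems(1) False by blast
    define S' where "S' = S(p := prod_encode ` (S p \<times> {1..m ?e}))"
    \<comment> \<open>\<open>g\<close> decodes the pair at \<open>p\<close>: the first entry is the
      physical index there, the second selects the value \<open>x k\<close> for \<open>l\<close>.
      The state on the smaller tree is \<psi> composed with \<open>g\<close>.\<close>
    define g where "g \<sigma> = \<sigma>(p := fst (prod_decode (\<sigma> p)), l := x (snd (prod_decode (\<sigma> p))))"
      for \<sigma> :: "'a \<Rightarrow> nat"
    have g_in: "g \<sigma> \<in> Pi\<^sub>E (insert l V) S" if \<sigma>: "\<sigma> \<in> Pi\<^sub>E V S'" for \<sigma>
    proof -
      have "\<sigma> p \<in> prod_encode ` (S p \<times> {1..m ?e})"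
        using PiE_mem[OF \<sigma> leaf.hyps(2)] by (simp add: S'_def)
      then have "fst (prod_decode (\<sigma> p)) \<in> S p" by auto
      moreover have "\<sigma> i \<in> S i" if "i \<in> V" "i \<noteq> p" for i
        using PiE_mem[OF \<sigma> that(1)] that(2) by (simp add: S'_def)
      moreover have "\<sigma> i = undefined" if "i \<notin> V" for i using \<sigma> that by (rule PiE_arb)
      ultimately show ?thesis
        using x leaf.hyps(2) \<open>p \<noteq> l\<close> by (intro PiE_I) (auto simp: g_def)
    qed
    have old: "factorable (Pi\<^sub>E V S') (graph_component (E - {{a, b}}) a)
        (graph_component (E - {{a, b}}) b) (m {a, b}) (\<lambda>\<sigma>. \<psi> (g \<sigma>))"
      if ab: "{a, b} \<in> E" and p: "p \<in> graph_component (E - {{a, b}}) a" for a b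
    proof -
      have ne: "a \<noteq> l" "b \<noteq> l" using ab notin by auto
      have eq: "?E - {{a, b}} = insert ?e (E - {{a, b}})" using ab notin by auto
      have notin': "l \<notin> \<Union>(E - {{a, b}})" using notin by auto
      define A where "A = graph_component (E - {{a, b}}) a"
      define B where "B = graph_component (E - {{a, b}}) b"
      have AB: "A \<inter> B = {}" "A \<union> B = V"
        using leaf_tree_split[OF leaf.hyps(1) ab] unfolding A_def B_def by blast+
      have pAB: "p \<in> A" "p \<notin> B" "l \<notin> B" using p AB leaf.hyps(3) unfolding A_def by blast+
      have "factorable (Pi\<^sub>E (insert l V) S) (graph_component (?E - {{a, b}}) a)
          (graph_component (?E - {{a, b}}) b) (m {a, b}) \<psi>"
        using leaf.prems(2) ab unfolding edge_factorable_def by blast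
      then have fac: "factorable (Pi\<^sub>E (insert l V) S) (insert l A) B (m {a, b}) \<psi>"
        unfolding eq graph_component_add_leaf[OF notin' ne(1) \<open>p \<noteq> l\<close>]
          graph_component_add_leaf[OF notin' ne(2) \<open>p \<noteq> l\<close>]
        using pAB by (simp add: A_def B_def)
      \<comment> \<open>The map \<open>g\<close> reads and changes only coordinates on the side
        containing \<open>p\<close>, to which \<open>l\<close> also belongs, so the factorization
        pulls back.\<close>
      have "factorable (Pi\<^sub>E V S') A B (m {a, b}) (\<lambda>\<sigma>. \<psi> (g \<sigma>))"
        using fac g_in
      proof (rule factorable_pullback)
        show "restrict (g \<sigma>) (insert l A) = restrict (g (restrict \<sigma> A)) (insert l A)" for \<sigma>
          using pAB(1) by (auto simp: g_def fun_eq_iff)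
        show "restrict (g \<sigma>) B = restrict \<sigma> B" for \<sigma>
          using pAB(2,3) by (auto simp: g_def fun_eq_iff)
      qed
      then show ?thesis by (simp add: A_def B_def)
    qed
    have "edge_factorable (Pi\<^sub>E V S') E m (\<lambda>\<sigma>. \<psi> (g \<sigma>))"
      unfolding edge_factorable_def
    proof (intro allI impI)
      fix a b assume ab: "{a, b} \<in> E"
      have swap: "{b, a} = {a, b}" by auto
      have "p \<in> graph_component (E - {{a, b}}) a \<or> p \<in> graph_component (E - {{a, b}}) b"
        using leaf_tree_split[OF leaf.hyps(1) ab] leaf.hyps(2) by auto
      then show "factorable (Pi\<^sub>E V S') (graph_component (E - {{a, b}}) a)
          (graph_component (E - {{a, b}}) b) (m {a, b}) (\<lambda>\<sigma>. \<psi> (g \<sigma>))"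
        using old[OF ab] old[of b a, unfolded swap] ab factorable_sym by blast
    qed
    moreover have "finite (S' i)" if "i \<in> V" for i
      using leaf.prems(1) leaf.hyps(2) that by (auto simp: S'_def)
    ultimately obtain T' where
      T': "\<And>\<sigma>. \<sigma> \<in> Pi\<^sub>E V S' \<Longrightarrow> \<psi> (g \<sigma>) = bond_sum V E m T' \<sigma>"
      using leaf.IH[of S' "\<lambda>\<sigma>. \<psi> (g \<sigma>)"] by blast
    \<comment> \<open>The leaf carries the interpolation coefficients. The tensor at
      \<open>p\<close> packs its physical index and the bond index of the new edge into the code
      expected by \<open>T'\<close>, and passes on only the bonds of \<open>E\<close>.\<close>
    define T where "T = T'(
      p := (\<lambda>s n. T' p (prod_encode (s, n ?e)) (restrict n (incident E p))),
      l := (\<lambda>s n. c (n ?e) s))"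
    have "\<psi> \<sigma> = bond_sum (insert l V) ?E m T \<sigma>" if \<sigma>: "\<sigma> \<in> Pi\<^sub>E (insert l V) S" for \<sigma>
    proof -
      define \<tau> where "\<tau> = restrict \<sigma> V"
      have \<sigma>_mem: "\<sigma> i \<in> S i" if "i \<in> insert l V" for i using PiE_mem[OF \<sigma> that] .
      have \<tau>: "\<tau> \<in> Pi\<^sub>E V S" using \<sigma>_mem by (auto simp: \<tau>_def)
      have \<tau>_eq: "\<tau>(l := \<sigma> l) = \<sigma>"
        using PiE_arb[OF \<sigma>] by (auto simp: \<tau>_def fun_eq_iff)
      \<comment> \<open>Decoding in \<open>absorb\<close> cancels the encoding in \<open>T\<close>,
        so the absorbed tensors agree with \<open>T'\<close> on the smaller tree.\<close>
      have step: "\<psi> (\<tau>(l := x k)) =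
          bond_sum V E m (absorb ?e p T) (\<sigma>(p := prod_encode (\<sigma> p, k)))"
        if k: "k \<in> {1..m ?e}" for k
      proof -
        let ?\<tau>' = "\<tau>(p := prod_encode (\<sigma> p, k))"
        have "?\<tau>' \<in> Pi\<^sub>E V S'"
          using \<sigma>_mem leaf.hyps(2) k by (auto simp: \<tau>_def S'_def intro!: PiE_I)
        moreover have "g ?\<tau>' = \<tau>(l := x k)"
          using leaf.hyps(2) by (auto simp: g_def \<tau>_def fun_eq_iff)
        ultimately have "\<psi> (\<tau>(l := x k)) = bond_sum V E m T' ?\<tau>'" using T' by metis
        also have "\<dots> = bond_sum V E m (absorb ?e p T) (\<sigma>(p := prod_encode (\<sigma> p, k)))"
        proof (rule bond_sum_cong)
          fix i and n :: "'a set \<Rightarrow> nat"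
          assume i: "i \<in> V" and n: "n \<in> extensional (incident E i)"
          show "T' i (?\<tau>' i) n = absorb ?e p T i ((\<sigma>(p := prod_encode (\<sigma> p, k))) i) n"
          proof (cases "i = p")
            case True
            have "?e \<notin> incident E p" using e_notin by (simp add: incident_def)
            then have "restrict (n(?e := k)) (incident E p) = n"
              using n True by (auto simp: fun_eq_iff extensional_def)
            then show ?thesis using True \<open>p \<noteq> l\<close> by (simp add: absorb_def T_def)
          next
            case False
            then show ?thesis using i leaf.hyps(3) by (auto simp: absorb_def T_def \<tau>_def)
          qed
        qed
        finally show ?thesis .
      qed
      have "\<psi> \<sigma> = (\<Sum>k\<in>{1..m ?e}. \<psi> (\<tau>(l := x k)) * c k (\<sigma> l))"
        using c[OF \<tau>, of "\<sigma> l"] \<sigma>_mem by (simp add: \<tau>_eq)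
      also have "\<dots> = bond_sum (insert l V) ?E m T \<sigma>"
        unfolding bond_sum_leaf[OF finV leaf_tree_edges[OF leaf.hyps(1)] leaf.hyps(2,3)]
        by (intro sum.cong refl) (simp add: step T_def)
      finally show ?thesis .
    qed
    then show ?thesis by blast
  qed
qed

section \<open>Schmidt ranks and the characterization\<close>

lemma schmidt_rank_le_iff_factorable:
  assumes "finite B" "A \<inter> B = {}"
  shows "schmidt_rank d A B \<psi> \<le> r \<longleftrightarrow> factorable (configs d (A \<union> B)) A B r \<psi>"
proof -
  have fin: "finite (configs d B)"
    unfolding configs_def using assms(1) by (intro finite_PiE) auto
  \<comment> \<open>For disjoint \<open>A\<close> and \<open>B\<close>, \<open>merge\<close> and the
    two restrictions are mutually inverse between pairs of configurations and configurations on the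
    union.\<close>
  have "(\<exists>u v. \<forall>\<alpha>\<in>configs d A. \<forall>\<beta>\<in>configs d B.
      \<psi> (merge A B (\<alpha>, \<beta>)) = (\<Sum>k\<in>{1..r}. u k \<alpha> * v k \<beta>)) \<longleftrightarrow>
    factorable (configs d (A \<union> B)) A B r \<psi>" (is "?L \<longleftrightarrow> ?R")
  proof
    assume ?L
    then obtain u v where uv: "\<And>\<alpha> \<beta>. \<alpha> \<in> configs d A \<Longrightarrow> \<beta> \<in> configs d B \<Longrightarrow>
        \<psi> (merge A B (\<alpha>, \<beta>)) = (\<Sum>k\<in>{1..r}. u k \<alpha> * v k \<beta>)" by blast
    show ?R
    proof (rule factorableI)
      fix \<sigma> assume \<sigma>: "\<sigma> \<in> configs d (A \<union> B)"
      have "merge A B (restrict \<sigma> A, restrict \<sigma> B) = \<sigma>"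
        using \<sigma> by (auto simp: merge_def fun_eq_iff configs_def PiE_def extensional_def)
      moreover have "restrict \<sigma> A \<in> configs d A" "restrict \<sigma> B \<in> configs d B"
        using \<sigma> by (auto simp: configs_def PiE_def Pi_def)
      ultimately show "\<psi> \<sigma> = (\<Sum>k\<in>{1..r}. u k (restrict \<sigma> A) * v k (restrict \<sigma> B))"
        using uv by metis
    qed
  next
    assume ?R
    then obtain u v where uv: "\<And>\<sigma>. \<sigma> \<in> configs d (A \<union> B) \<Longrightarrow>
        \<psi> \<sigma> = (\<Sum>k\<in>{1..r}. u k (restrict \<sigma> A) * v k (restrict \<sigma> B))"
      unfolding factorable_def by blast
    have "\<psi> (merge A B (\<alpha>, \<beta>)) = (\<Sum>k\<in>{1..r}. u k \<alpha> * v k \<beta>)"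
      if "\<alpha> \<in> configs d A" "\<beta> \<in> configs d B" for \<alpha> \<beta>
    proof -
      have "merge A B (\<alpha>, \<beta>) \<in> configs d (A \<union> B)"
        using that by (auto simp: merge_def configs_def PiE_def Pi_def extensional_def)
      moreover have "restrict (merge A B (\<alpha>, \<beta>)) A = \<alpha>" "restrict (merge A B (\<alpha>, \<beta>)) B = \<beta>"
        using that assms(2)
        by (auto simp: merge_def configs_def fun_eq_iff PiE_def extensional_def)
      ultimately show ?thesis using uv by metis
    qed
    then show ?L by blast
  qed
  then show ?thesis unfolding schmidt_rank_def matrix_rank_le_iff_factor[OF fin] .
qed

lemma schmidt_ranks_iff_edge_factorable:
  assumes "leaf_tree V E"
  shows "(\<forall>a b. {a, b} \<in> E \<longrightarrow>
      schmidt_rank d (graph_component (E - {{a, b}}) a) (graph_component (E - {{a, b}}) b) \<psi>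
        \<le> m {a, b}) \<longleftrightarrow> edge_factorable (configs d V) E m \<psi>"
proof -
  have "schmidt_rank d (graph_component (E - {{a, b}}) a) (graph_component (E - {{a, b}}) b) \<psi>
      \<le> m {a, b} \<longleftrightarrow> factorable (configs d V) (graph_component (E - {{a, b}}) a)
        (graph_component (E - {{a, b}}) b) (m {a, b}) \<psi>"
    if "{a, b} \<in> E" for a b
  proof -
    note split = leaf_tree_split[OF assms that]
    have "finite (graph_component (E - {{a, b}}) b)"
      using split leaf_tree_finite[OF assms] by (metis finite_Un)
    from schmidt_rank_le_iff_factorable[OF this, of "graph_component (E - {{a, b}}) a"]
    show ?thesis using split by simp
  qed
  then show ?thesis unfolding edge_factorable_def by blast
qed

lemma TTNS_eq_schmidt_rank_bounded:
  assumes "leaf_tree V E"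
  shows "TTNS V E m d = {\<psi> \<in> state_space d V. state_norm d V \<psi> = 1 \<and>
    (\<forall>a b. {a, b} \<in> E \<longrightarrow>
      schmidt_rank d (graph_component (E - {{a, b}}) a) (graph_component (E - {{a, b}}) b) \<psi>
        \<le> m {a, b})}"
proof -
  \<comment> \<open>The equivalence is shown without normalization; the norm condition is then
    imposed on both sides.\<close>
  have "(\<exists>T. \<psi> = contract V E m d T) \<longleftrightarrow>
      \<psi> \<in> state_space d V \<and> edge_factorable (configs d V) E m \<psi>" for \<psi>
  proof
    assume "\<exists>T. \<psi> = contract V E m d T"
    then obtain T where T: "\<psi> = contract V E m d T" ..
    have "\<psi> \<sigma> = bond_sum V E m T \<sigma>" if "\<sigma> \<in> configs d V" for \<sigma>
      using that by (simp add: T contract_bond_sum)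
    then have "edge_factorable (configs d V) E m \<psi>"
      using bond_sum_edge_factorable[OF assms, of m T] factorable_restrict[OF _ subset_UNIV]
      unfolding edge_factorable_def by blast
    then show "\<psi> \<in> state_space d V \<and> edge_factorable (configs d V) E m \<psi>"
      by (simp add: T contract_def state_space_def)
  next
    assume \<psi>: "\<psi> \<in> state_space d V \<and> edge_factorable (configs d V) E m \<psi>"
    then obtain T where "\<forall>\<sigma>\<in>configs d V. \<psi> \<sigma> = bond_sum V E m T \<sigma>"
      using edge_factorable_imp_bond_sum[OF assms, of "\<lambda>i. {1..d i}" m \<psi>]
      by (auto simp: configs_def)
    then have "\<psi> = contract V E m d T"
      using \<psi> by (auto simp: contract_bond_sum state_space_def fun_eq_iff)
    then show "\<exists>T. \<psi> = contract V E m d T" by blast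
  qed
  then show ?thesis
    unfolding TTNS_def schmidt_ranks_iff_edge_factorable[OF assms] by blast
qed

section \<open>Closedness\<close>

text \<open>The modulus of a single coefficient is bounded by the Euclidean norm, and off
  \<open>configs\<close> all states vanish.\<close>

lemma limitin_state_topology_pointwise:
  assumes "finite V" "limitin (state_topology d V) f \<psi> sequentially"
  shows "(\<lambda>n. f n \<sigma>) \<longlonglongrightarrow> \<psi> \<sigma>"
proof -
  interpret Metric_space "state_space d V" "state_dist d V"
    by (rule Metric_space_state_space[OF assms(1)])
  have \<psi>: "\<psi> \<in> state_space d V" and f: "\<forall>\<^sub>F n in sequentially. f n \<in> state_space d V"
    and dist: "(\<lambda>n. state_dist d V (f n) \<psi>) \<longlonglongrightarrow> 0"
    using assms(2) by (auto simp: limitin_metric_dist_null)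
  have fin: "finite (configs d V)"
    unfolding configs_def using assms(1) by (intro finite_PiE) auto
  have "cmod (\<phi> \<sigma> - \<psi> \<sigma>) \<le> state_dist d V \<phi> \<psi>" if "\<phi> \<in> state_space d V" for \<phi>
  proof (cases "\<sigma> \<in> configs d V")
    case True
    then show ?thesis
      using member_le_L2_set[OF fin True, of "\<lambda>\<sigma>. cmod (\<phi> \<sigma> - \<psi> \<sigma>)"]
      by (simp add: state_dist_def state_norm_def)
  next
    case False
    then show ?thesis using that \<psi> by (simp add: state_space_def)
  qed
  then have "\<forall>\<^sub>F n in sequentially. norm (f n \<sigma> - \<psi> \<sigma>) \<le> state_dist d V (f n) \<psi>"
    using f by (rule eventually_mono[rotated]) auto
  from Lim_null_comparison[OF this dist] show ?thesis by (simp add: LIM_zero_iff)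
qed

text \<open>In a metric space closedness can be tested on sequences. Limits hold coefficientwise, so
  the norm passes to the limit by continuity and each rank bound by
  \<open>matrix_rank_le_limit\<close>.\<close>

lemma closedin_schmidt_rank_bounded:
  assumes "finite V" "\<And>A B r. (A, B, r) \<in> R \<Longrightarrow> finite A \<and> finite B"
  shows "closedin (state_topology d V) {\<psi> \<in> state_space d V. state_norm d V \<psi> = 1 \<and>
    (\<forall>(A, B, r)\<in>R. schmidt_rank d A B \<psi> \<le> r)}" (is "closedin _ ?S")
proof -
  interpret Metric_space "state_space d V" "state_dist d V"
    by (rule Metric_space_state_space[OF assms(1)])
  have "\<psi> \<in> ?S" if f: "range f \<subseteq> ?S" and lim: "limitin mtopology f \<psi> sequentially" for f \<psi>
  proof -
    note pointwise = limitin_state_topology_pointwise[OF assms(1) lim]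
    have "(\<lambda>n. state_norm d V (f n)) \<longlonglongrightarrow> state_norm d V \<psi>"
      unfolding state_norm_def L2_set_def by (intro tendsto_intros pointwise)
    moreover have "(\<lambda>n. state_norm d V (f n)) = (\<lambda>n. 1)" using f by auto
    ultimately have "state_norm d V \<psi> = 1" using LIMSEQ_unique[OF _ tendsto_const] by metis
    moreover have "schmidt_rank d A B \<psi> \<le> r" if R: "(A, B, r) \<in> R" for A B r
      unfolding schmidt_rank_def
    proof (rule matrix_rank_le_limit[OF _ _ pointwise])
      show "finite (configs d A)" "finite (configs d B)"
        unfolding configs_def using assms(2)[OF R] by (auto intro!: finite_PiE)
      show "matrix_rank (configs d A) (configs d B) (\<lambda>\<sigma> \<tau>. f n (merge A B (\<sigma>, \<tau>))) \<le> r" for n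
      proof -
        have "f n \<in> ?S" using f by blast
        then have "schmidt_rank d A B (f n) \<le> r" using R by blast
        then show ?thesis by (simp add: schmidt_rank_def)
      qed
    qed
    moreover have "\<psi> \<in> state_space d V" using lim by (simp add: limitin_metric_dist_null)
    ultimately show ?thesis by auto
  qed
  then show ?thesis unfolding metric_closedin_iff_sequentially_closed by blast
qed

theorem proposition2:
  fixes N :: nat and E :: "nat set set" and m :: "nat set \<Rightarrow> nat" and d :: "nat \<Rightarrow> nat"
  assumes "is_tree {1..N} E"
    and "\<And>e. e \<in> E \<Longrightarrow> 1 \<le> m e"
    and "\<And>i. i \<in> {1..N} \<Longrightarrow> 1 \<le> d i"
  shows "closedin (state_topology d {1..N}) (TTNS {1..N} E m d) \<and>
    TTNS {1..N} E m d =
      {\<psi> \<in> state_space d {1..N}. state_norm d {1..N} \<psi> = 1 \<and>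
        (\<forall>a b. {a, b} \<in> E \<longrightarrow>
          schmidt_rank d (graph_component (E - {{a, b}}) a) (graph_component (E - {{a, b}}) b) \<psi>
            \<le> m {a, b})}"
proof -
  have tree: "leaf_tree {1..N} E" using assms(1) by (rule is_tree_imp_leaf_tree)
  \<comment> \<open>Collecting both sides of each cut and its bond dimension in one set of triples
    brings the edge conditions into the form of the closedness lemma.\<close>
  define R where "R = {(graph_component (E - {{a, b}}) a, graph_component (E - {{a, b}}) b,
      m {a, b}) | a b. {a, b} \<in> E}"
  have fin: "finite A \<and> finite B" if "(A, B, r) \<in> R" for A B r
  proof -
    have "A \<union> B = {1..N}" using that leaf_tree_split[OF tree] by (auto simp: R_def)
    then show ?thesis by (metis finite_Un finite_atLeastAtMost)
  qed
  have eq: "TTNS {1..N} E m d = {\<psi> \<in> state_space d {1..N}. state_norm d {1..N} \<psi> = 1 \<and>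
      (\<forall>(A, B, r)\<in>R. schmidt_rank d A B \<psi> \<le> r)}"
    unfolding TTNS_eq_schmidt_rank_bounded[OF tree] R_def by blast
  have "closedin (state_topology d {1..N}) (TTNS {1..N} E m d)"
    unfolding eq by (rule closedin_schmidt_rank_bounded[OF finite_atLeastAtMost fin])
  then show ?thesis using TTNS_eq_schmidt_rank_bounded[OF tree, of m d] by (rule conjI)
qed

end
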